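(* Let $n\ge 1$ be an integer. Then $$(xI)^n = \sum_{k=0}^{n-1} (-1)^k\, a(n-1,k)\, x^{\,n-k}\, I^{\,n+k},$$ as an identity of operators, where $I$ is the Volterra operator $(If)(x)=\int_0^x f(t)\,dt$, $x$ denotes the operator of multiplication by the variable $x$, and $a(n,k)=\dfrac{(n+k)!}{2^k\,k!\,(n-k)!}$ are the Bessel numbers.
   Context: The Volterra operator $I$ acts on functions by $(If)(x)=\int_0^x f(t)\,dt$, and $I^m$ is its $m$-fold composition. The operator $xI$ sends $f$ to the function $x\mapsto x\int_0^x f(t)\,dt$, and $(xI)^n$ is its $n$-fold composition. The operator $x^jI^m$ applies $I^m$ and then multiplies by $x^j$. The Bessel numbers are $a(n,k)=[x^k]\,y_n(x)=\frac{(n+k)!}{2^k\,k!\,(n-k)!}$ for $0\le k\le n$, where $y_n(x)=\sum_{k=0}^{n}\frac{(n+k)!}{2^k\,k!\,(n-k)!}x^k$ is the $n$-th Bessel polynomial and $[x^k]$ denotes the coefficient of $x^k$. *)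

theory Defs
  imports "HOL-Analysis.Analysis"
begin

text \<open>
  The sort \<open>{real_normed_field, euclidean_space}\<close> covers both scalar fields, \<^typ>\<open>real\<close> and
  \<^typ>\<open>complex\<close>. The interval integral is oriented, so \<open>volterra f x\<close> is minus the integral
  over \<open>[x, 0]\<close> when \<open>x < 0\<close>; the underlying measure is the completed Lebesgue measure.
\<close>

definition volterra ::
    "(real \<Rightarrow> 'a::{real_normed_field, euclidean_space}) \<Rightarrow> real \<Rightarrow> 'a" where
  "volterra f = (\<lambda>x. LINT t=ereal 0..ereal x|lebesgue. f t)"

definition mult_x ::
    "(real \<Rightarrow> 'a::{real_normed_field, euclidean_space}) \<Rightarrow> real \<Rightarrow> 'a" where
  "mult_x f = (\<lambda>x. of_real x * f x)"

text \<open>Meaningful for \<open>k \<le> n\<close> only, because of the truncated subtraction.\<close>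

definition bessel_number :: "nat \<Rightarrow> nat \<Rightarrow> real" where
  "bessel_number n k = fact (n + k) / (2 ^ k * fact k * fact (n - k))"

end

theory Submission
  imports Defs
begin

text \<open>
  Write \<open>I\<close> for the Volterra operator and \<open>x\<close> for multiplication by the variable. Everything
  rests on the commutation rule \<open>I x = x I - I\<^sup>2\<close>, which is integration by parts: if \<open>H = I h\<close>,
  then \<open>x H\<close> is the antiderivative of \<open>H + x h\<close> that vanishes at \<open>0\<close>. Iterating it gives
  \<open>I\<^sup>m x = x I\<^sup>m - m I\<^bsup>m+1\<^esup>\<close> (lemma \<open>volterra_funpow_mult_x\<close>).

  The identity then follows by induction on \<open>n\<close>, peeling off the \<^emph>\<open>innermost\<close> factor in
  \<open>(x I)\<^bsup>n+1\<^esup> = (x I)\<^sup>n (x I)\<close>, because then each term of the sum produces only two new terms: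
  \<open>x\<^bsup>n-k\<^esup> I\<^bsup>n+k\<^esup> x I = x\<^bsup>n+1-k\<^esup> I\<^bsup>n+1+k\<^esup> - (n+k) x\<^bsup>n-k\<^esup> I\<^bsup>n+k+2\<^esup>\<close>.
  Collecting equal monomials leaves the recurrence
  \<open>a(n,k) = a(n-1,k) + (n+k-1) a(n-1,k-1)\<close> of the Bessel numbers
  (lemma \<open>sum_bessel_number_Suc\<close>).

  The value at \<open>x\<close> depends only on \<open>f\<close> between \<open>0\<close> and \<open>x\<close>, so all the analysis takes place on a
  compact interval \<open>{a..b}\<close> that contains \<open>0\<close>. The function \<open>f\<close> itself is only integrable, but the
  innermost factor makes it continuous, and the commutation rule is needed for continuous
  functions alone, where the fundamental theorem of calculus applies everywhere.
\<close>

section \<open>The Volterra operator on a compact interval around 0\<close>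

lemma volterra_0: "volterra f 0 = 0"
  by (simp add: volterra_def interval_lebesgue_integral_def set_lebesgue_integral_def)

text \<open>
  Moving the base point of integration to the left endpoint \<open>a\<close> removes the case distinction on
  the sign of \<open>x\<close>.
\<close>

lemma volterra_eq_integral:
  fixes f :: "real \<Rightarrow> 'a::{real_normed_field, euclidean_space}"
  assumes f: "f absolutely_integrable_on {a..b}" and "0 \<in> {a..b}" and "x \<in> {a..b}"
  shows "volterra f x = integral {a..x} f - integral {a..0} f"
proof -
  have int: "f integrable_on {a..b}"
    using f by (rule set_lebesgue_integral_eq_integral(1))
  have "(LINT t:{u<..<v}|lebesgue. f t) = integral {a..v} f - integral {a..u} f"
    if "a \<le> u" "u \<le> v" "v \<le> b" for u v
  proof -
    have "f absolutely_integrable_on {u<..<v}"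
      using that by (intro set_integrable_subset[OF f]) auto
    then have "(LINT t:{u<..<v}|lebesgue. f t) = integral {u<..<v} f"
      by (rule set_lebesgue_integral_eq_integral(2))
    also have "\<dots> = integral {u..v} f"
      by (rule integral_open_interval_real[symmetric])
    also have "\<dots> = integral {a..v} f - integral {a..u} f"
      using Henstock_Kurzweil_Integration.integral_combine[of a u v f] that
        integrable_on_subinterval[OF int, of a v]
      by (auto simp: algebra_simps)
    finally show ?thesis .
  qed
  from this[of 0 x] this[of x 0] show ?thesis
    using assms(2,3)
    by (cases "x = 0") (auto simp: volterra_0 volterra_def interval_lebesgue_integral_def)
qed

lemma volterra_cong:
  assumes "0 \<in> {a..b}" and "x \<in> {a..b}" and "\<And>t. t \<in> {a..b} \<Longrightarrow> f t = g t"
  shows "volterra f x = volterra g x"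
  unfolding volterra_def interval_lebesgue_integral_def
  using assms by (auto intro!: set_lebesgue_integral_cong)

lemma continuous_on_volterra:
  fixes f :: "real \<Rightarrow> 'a::{real_normed_field, euclidean_space}"
  assumes f: "f absolutely_integrable_on {a..b}" and "0 \<in> {a..b}"
  shows "continuous_on {a..b} (volterra f)"
proof -
  have "continuous_on {a..b} (\<lambda>x. integral {a..x} f - integral {a..0} f)"
    using set_lebesgue_integral_eq_integral(1)[OF f]
    by (intro continuous_intros indefinite_integral_continuous_1)
  then show ?thesis
    by (rule continuous_on_eq) (rule volterra_eq_integral[OF assms, symmetric])
qed

lemma continuous_on_volterra_funpow:
  fixes h :: "real \<Rightarrow> 'a::{real_normed_field, euclidean_space}"
  assumes "continuous_on {a..b} h" and "0 \<in> {a..b}"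
  shows "continuous_on {a..b} ((volterra ^^ m) h)"
  by (induction m)
    (use assms in \<open>auto intro!: continuous_on_volterra absolutely_integrable_continuous_real\<close>)

lemma volterra_has_vector_derivative:
  fixes h :: "real \<Rightarrow> 'a::{real_normed_field, euclidean_space}"
  assumes h: "continuous_on {a..b} h" and 0: "0 \<in> {a..b}" and "x \<in> {a..b}"
  shows "(volterra h has_vector_derivative h x) (at x within {a..b})"
proof -
  have "((\<lambda>u. integral {a..u} h - integral {a..0} h) has_vector_derivative h x - 0)
    (at x within {a..b})"
    using assms by (intro derivative_intros integral_has_vector_derivative)
  then have "((\<lambda>u. integral {a..u} h - integral {a..0} h) has_vector_derivative h x)
    (at x within {a..b})"
    by simp
  then show ?thesis
    by (rule has_vector_derivative_transform[rotated 2])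
      (use assms volterra_eq_integral[OF absolutely_integrable_continuous_real[OF h] 0] in auto)
qed

text \<open>
  Identities between iterated integrals of continuous functions reduce to computing derivatives:
  \<open>volterra h\<close> is the only antiderivative of \<open>h\<close> that vanishes at \<open>0\<close>.
\<close>

lemma volterra_eqI:
  fixes h :: "real \<Rightarrow> 'a::{real_normed_field, euclidean_space}"
  assumes h: "continuous_on {a..b} h" and 0: "0 \<in> {a..b}" and x: "x \<in> {a..b}"
    and F: "\<And>t. t \<in> {a..b} \<Longrightarrow> (F has_vector_derivative h t) (at t within {a..b})"
    and "F 0 = 0"
  shows "volterra h x = F x"
proof -
  have "((\<lambda>t. volterra h t - F t) has_vector_derivative 0) (at t within {a..b})"
    if "t \<in> {a..b}" for t
    using has_vector_derivative_diff[OF volterra_has_vector_derivative[OF h 0 that] F[OF that]]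
    by simp
  then obtain c where c: "\<And>t. t \<in> {a..b} \<Longrightarrow> volterra h t - F t = c"
    using has_vector_derivative_zero_constant[OF convex_real_interval(5)] by blast
  show ?thesis
    using c[OF 0] c[OF x] \<open>F 0 = 0\<close> by (simp add: volterra_0)
qed

section \<open>Commuting integration past multiplication by the variable\<close>

lemma mult_x_funpow: "(mult_x ^^ m) h x = of_real x ^ m * h x"
  by (induction m) (auto simp: mult_x_def)

text \<open>
  The step from \<open>m\<close> to \<open>m + 1\<close> applies \<open>I\<close> to the formula for \<open>m\<close> and integrates by parts, with
  \<open>G = I\<^sup>m h\<close>: the claimed value \<open>x (I G) - (m + 1) I (I G)\<close> has derivative
  \<open>I G + x G - (m + 1) I G = x G - m (I G)\<close>.
\<close>

lemma volterra_funpow_mult_x: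
  fixes h :: "real \<Rightarrow> 'a::{real_normed_field, euclidean_space}"
  assumes h: "continuous_on {a..b} h" and 0: "0 \<in> {a..b}" and "x \<in> {a..b}"
  shows "(volterra ^^ m) (mult_x h) x =
    of_real x * (volterra ^^ m) h x - of_nat m * (volterra ^^ Suc m) h x"
  using \<open>x \<in> {a..b}\<close>
proof (induction m arbitrary: x)
  case 0
  show ?case by (simp add: mult_x_def)
next
  case (Suc m)
  define G where "G = (volterra ^^ m) h"
  have G: "continuous_on {a..b} G" and IG: "continuous_on {a..b} (volterra G)"
    using continuous_on_volterra_funpow[OF h 0, of m]
      continuous_on_volterra_funpow[OF h 0, of "Suc m"]
    by (simp_all add: G_def)
  have "(volterra ^^ Suc m) (mult_x h) x =
      volterra (\<lambda>t. of_real t * G t - of_nat m * volterra G t) x"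
    using Suc.IH by (auto simp: G_def intro!: volterra_cong[OF 0 Suc.prems])
  also have "\<dots> = of_real x * volterra G x - of_nat (Suc m) * volterra (volterra G) x"
  proof (rule volterra_eqI[OF _ 0 Suc.prems])
    show "continuous_on {a..b} (\<lambda>t. of_real t * G t - of_nat m * volterra G t)"
      by (intro continuous_intros G IG)
  next
    fix t assume t: "t \<in> {a..b}"
    have id: "((\<lambda>t. of_real t :: 'a) has_vector_derivative 1) (at t within {a..b})"
      using has_vector_derivative_of_real[OF DERIV_ident] by simp
    have "((\<lambda>t. of_real t * volterra G t - of_nat (Suc m) * volterra (volterra G) t)
        has_vector_derivative (of_real t * G t + 1 * volterra G t - of_nat (Suc m) * volterra G t))
        (at t within {a..b})"
      by (intro has_vector_derivative_diff has_vector_derivative_mult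
          has_vector_derivative_mult_right id volterra_has_vector_derivative G IG 0 t)
    then show "((\<lambda>t. of_real t * volterra G t - of_nat (Suc m) * volterra (volterra G) t)
        has_vector_derivative (of_real t * G t - of_nat m * volterra G t)) (at t within {a..b})"
      by (simp add: algebra_simps)
  qed (simp add: volterra_0)
  finally show ?case
    by (simp add: G_def)
qed

section \<open>The recurrence of the Bessel numbers\<close>

lemma bessel_number_0: "bessel_number n 0 = 1"
  by (simp add: bessel_number_def)

lemma bessel_number_Suc_Suc:
  assumes "k < n"
  shows "bessel_number (Suc n) (Suc k) =
    bessel_number n (Suc k) + of_nat (n + k + 1) * bessel_number n k"
proof -
  obtain d where n: "n = k + Suc d"
    using assms less_imp_Suc_add by (metis add_Suc_right)
  define F K D P :: real where "F = fact (2 * k + d + 1)" and "K = fact k" and "D = fact d"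
    and "P = 2 ^ k"
  have pos: "K > 0" "D > 0" "P > 0"
    by (simp_all add: K_def D_def P_def)
  have e: "Suc n + Suc k = Suc (Suc (2 * k + d + 1))" "n + Suc k = Suc (2 * k + d + 1)"
    "n + k = 2 * k + d + 1" "Suc n - Suc k = Suc d" "n - Suc k = d" "n - k = Suc d"
    by (simp_all add: n)
  have "bessel_number (Suc n) (Suc k) =
      (2 * real k + real d + 3) * (2 * real k + real d + 2) * F /
        (2 * P * ((real k + 1) * K) * ((real d + 1) * D))"
    unfolding bessel_number_def e fact_Suc power_Suc F_def K_def D_def P_def by (simp add: ac_simps)
  moreover have "bessel_number n (Suc k) =
      (2 * real k + real d + 2) * F / (2 * P * ((real k + 1) * K) * D)"
    unfolding bessel_number_def e fact_Suc power_Suc F_def K_def D_def P_def by (simp add: ac_simps)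
  moreover have "bessel_number n k = F / (P * K * ((real d + 1) * D))"
    unfolding bessel_number_def e fact_Suc F_def K_def D_def P_def by (simp add: ac_simps)
  moreover have "of_nat (n + k + 1) = 2 * real k + real d + 2"
    by (simp add: n)
  moreover have "(2 * x + y + 3) * (2 * x + y + 2) * F / (2 * P * ((x + 1) * K) * ((y + 1) * D)) =
      (2 * x + y + 2) * F / (2 * P * ((x + 1) * K) * D) +
      (2 * x + y + 2) * (F / (P * K * ((y + 1) * D)))" if "x + 1 > 0" "y + 1 > 0" for x y
    using pos that by (simp add: divide_simps) algebra
  ultimately show ?thesis
    by simp
qed

text \<open>
  On the diagonal the term \<open>a(n, n + 1)\<close> of the recurrence is the coefficient of a power beyond the
  degree of \<open>y\<^sub>n\<close>; it has to be dropped, since the truncated subtraction gives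
  \<open>bessel_number n (Suc n)\<close> a nonzero value.
\<close>

lemma bessel_number_Suc_diag:
  "bessel_number (Suc n) (Suc n) = of_nat (2 * n + 1) * bessel_number n n"
proof -
  have e: "Suc n + Suc n = Suc (Suc (n + n))"
    by simp
  have "bessel_number (Suc n) (Suc n) =
      (2 * real n + 2) * ((2 * real n + 1) * fact (n + n)) / (2 * 2 ^ n * ((real n + 1) * fact n))"
    unfolding bessel_number_def e fact_Suc power_Suc by (simp add: ac_simps)
  also have "\<dots> = (2 * real n + 1) * (fact (n + n) / (2 ^ n * fact n))"
    by (simp add: divide_simps)
  finally show ?thesis
    by (simp add: bessel_number_def)
qed

text \<open>
  This is the recurrence in summed form. The sequence \<open>p\<close> stands for the monomials
  \<open>x\<^bsup>n+2-k\<^esup> I\<^bsup>n+2+k\<^esup>\<close>, and the left-hand side is what commuting \<open>I\<close> past \<open>x\<close> produces.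
\<close>

lemma sum_bessel_number_Suc:
  fixes p :: "nat \<Rightarrow> 'a::real_normed_field"
  shows "(\<Sum>k\<le>n. of_real ((-1) ^ k * bessel_number n k) * (p k - of_nat (n + k + 1) * p (Suc k))) =
    (\<Sum>k\<le>Suc n. of_real ((-1) ^ k * bessel_number (Suc n) k) * p k)"
proof -
  define c :: "nat \<Rightarrow> nat \<Rightarrow> 'a" where "c n k = of_real ((-1) ^ k * bessel_number n k)" for n k
  have c0: "c m 0 = 1" for m
    by (simp add: c_def bessel_number_0)
  have step: "c (Suc n) (Suc k) = c n (Suc k) - of_nat (n + k + 1) * c n k" if "k < n" for k
    by (simp add: c_def bessel_number_Suc_Suc[OF that] algebra_simps)
  have diag: "c (Suc n) (Suc n) = - of_nat (n + n + 1) * c n n"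
    by (simp add: c_def bessel_number_Suc_diag algebra_simps)
  have "(\<Sum>k\<le>n. c n k * (p k - of_nat (n + k + 1) * p (Suc k))) =
      (\<Sum>k\<le>n. c n k * p k) - (\<Sum>k\<le>n. of_nat (n + k + 1) * c n k * p (Suc k))"
    by (simp add: right_diff_distrib sum_subtractf mult_ac)
  also have "(\<Sum>k\<le>n. c n k * p k) = p 0 + (\<Sum>k<n. c n (Suc k) * p (Suc k))"
    by (simp add: sum.atMost_shift c0)
  also have "(\<Sum>k\<le>n. of_nat (n + k + 1) * c n k * p (Suc k)) =
      (\<Sum>k<n. of_nat (n + k + 1) * c n k * p (Suc k)) - c (Suc n) (Suc n) * p (Suc n)"
    unfolding lessThan_Suc_atMost[symmetric] sum.lessThan_Suc by (simp add: diag algebra_simps)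
  also have "p 0 + (\<Sum>k<n. c n (Suc k) * p (Suc k)) -
        ((\<Sum>k<n. of_nat (n + k + 1) * c n k * p (Suc k)) - c (Suc n) (Suc n) * p (Suc n)) =
      p 0 + (\<Sum>k<n. c (Suc n) (Suc k) * p (Suc k)) + c (Suc n) (Suc n) * p (Suc n)"
    by (simp add: step left_diff_distrib sum_subtractf del: of_nat_add of_nat_Suc)
  also have "\<dots> = (\<Sum>k\<le>Suc n. c (Suc n) k * p k)"
    by (simp add: sum.atMost_shift[of _ n] c0)
  finally show ?thesis
    unfolding c_def .
qed

section \<open>Powers of \<open>xI\<close>\<close>

text \<open>
  The induction has to generalize over \<open>f\<close>: the step applies the formula for \<open>n\<close> to \<open>x I f\<close>,
  which is continuous and hence again integrable.
\<close>

lemma mult_x_volterra_funpow_interval: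
  fixes f :: "real \<Rightarrow> 'a::{real_normed_field, euclidean_space}"
  assumes "f absolutely_integrable_on {a..b}" and 0: "0 \<in> {a..b}" and x: "x \<in> {a..b}"
  shows "((mult_x \<circ> volterra) ^^ Suc n) f x =
    (\<Sum>k\<le>n. of_real ((-1) ^ k * bessel_number n k) *
      (of_real x ^ (Suc n - k) * (volterra ^^ (Suc n + k)) f x))"
  using assms(1)
proof (induction n arbitrary: f)
  case 0
  show ?case
    by (simp add: bessel_number_0 mult_x_def)
next
  case (Suc n)
  define h where "h = volterra f"
  define p where "p k = of_real x ^ (Suc (Suc n) - k) * (volterra ^^ (Suc (Suc n) + k)) f x" for k
  have h: "continuous_on {a..b} h"
    unfolding h_def by (rule continuous_on_volterra[OF Suc.prems 0])
  then have xh: "mult_x h absolutely_integrable_on {a..b}"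
    unfolding mult_x_def by (intro absolutely_integrable_continuous_real continuous_intros)
  have "((mult_x \<circ> volterra) ^^ Suc (Suc n)) f x = ((mult_x \<circ> volterra) ^^ Suc n) (mult_x h) x"
    by (simp only: funpow_Suc_right[of "Suc n"] h_def o_apply)
  also have "\<dots> = (\<Sum>k\<le>n. of_real ((-1) ^ k * bessel_number n k) *
      (of_real x ^ (Suc n - k) * (volterra ^^ (Suc n + k)) (mult_x h) x))"
    by (rule Suc.IH[OF xh])
  also have "\<dots> = (\<Sum>k\<le>n. of_real ((-1) ^ k * bessel_number n k) *
      (p k - of_nat (n + k + 1) * p (Suc k)))"
  proof (intro sum.cong refl arg_cong2[where f = "(*)"])
    fix k assume k: "k \<in> {..n}"
    have shift: "(volterra ^^ m) h = (volterra ^^ Suc m) f" for m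
      by (simp add: h_def funpow_swap1)
    have pow: "of_real x ^ (Suc (Suc n) - k) = of_real x * (of_real x :: 'a) ^ (Suc n - k)"
      using k by (simp add: Suc_diff_le)
    show "of_real x ^ (Suc n - k) * (volterra ^^ (Suc n + k)) (mult_x h) x =
        p k - of_nat (n + k + 1) * p (Suc k)"
      unfolding volterra_funpow_mult_x[OF h 0 x] shift p_def pow
      by (simp add: algebra_simps del: funpow.simps)
  qed
  also have "\<dots> = (\<Sum>k\<le>Suc n. of_real ((-1) ^ k * bessel_number (Suc n) k) * p k)"
    by (rule sum_bessel_number_Suc)
  finally show ?case
    unfolding p_def .
qed

theorem theorem2p1:
  fixes n :: nat
    and J :: "real set"
    and f :: "real \<Rightarrow> 'a::{real_normed_field, euclidean_space}"
  assumes "n \<ge> 1"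
    and "is_interval J" and "0 \<in> J"
    and "\<And>a b. {a..b} \<subseteq> J \<Longrightarrow> f absolutely_integrable_on {a..b}"
  shows "\<forall>x\<in>J. ((mult_x \<circ> volterra) ^^ n) f x =
    (\<Sum>k=0..n - 1. of_real ((-1) ^ k * bessel_number (n - 1) k) *
      ((mult_x ^^ (n - k)) \<circ> (volterra ^^ (n + k))) f x)"
proof
  fix x assume "x \<in> J"
  define m where "m = n - 1"
  have n: "n = Suc m"
    using \<open>n \<ge> 1\<close> by (simp add: m_def)
  have "min 0 x \<in> J" and "max 0 x \<in> J"
    using \<open>0 \<in> J\<close> \<open>x \<in> J\<close> by (simp_all add: min_def max_def)
  then have "{min 0 x..max 0 x} \<subseteq> J"
    using \<open>is_interval J\<close> unfolding is_interval_1 by (meson atLeastAtMost_iff subsetI)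
  then have "f absolutely_integrable_on {min 0 x..max 0 x}"
    by (rule assms(4))
  then have "((mult_x \<circ> volterra) ^^ Suc m) f x =
    (\<Sum>k\<le>m. of_real ((-1) ^ k * bessel_number m k) *
      (of_real x ^ (Suc m - k) * (volterra ^^ (Suc m + k)) f x))"
    by (rule mult_x_volterra_funpow_interval) auto
  then show "((mult_x \<circ> volterra) ^^ n) f x =
    (\<Sum>k=0..n - 1. of_real ((-1) ^ k * bessel_number (n - 1) k) *
      ((mult_x ^^ (n - k)) \<circ> (volterra ^^ (n + k))) f x)"
    unfolding n o_apply mult_x_funpow diff_Suc_1 atMost_atLeast0 .
qed

end
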